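(* Let $V$ be a finite set, $\mathcal{M}(V,\mathcal{I})$ a matroid of rank $k\ge 1$, $f:2^V\to\mathbb{R}_{\ge 0}$ a normalized monotone submodular function, $0<\epsilon\le 1$, and $MAX>0$ such that $\max_{e\in V} f(\{e\})\in(MAX/2,MAX]$. Suppose an integer $T\ge 0$, sets $R_0,\dots,R_{T+1}\subseteq V$, sets $I_0,\dots,I_T,I'_0,\dots,I'_T\subseteq V$, elements $e_1,\dots,e_T\in V$ and real weights $w(e_1),\dots,w(e_T)$ satisfy the following level invariants: (Starter) $R_0=V$ and $I_0=I'_0=\emptyset$; (Survivor) for $1\le i\le T+1$, $R_i=\{e\in R_{i-1}\setminus\{e_{i-1}\}:\ \textsc{Promote}(I_{i-1},I'_{i-1},e,w)\ne\textsc{Fail}\}$ (for $i=1$, $R_0\setminus\{e_0\}$ means $R_0$); (Independent) for $1\le i\le T$, $I_i=(I_{i-1}\cup\{e_i\})\setminus \textsc{Promote}(I_{i-1},I'_{i-1},e_i,w)$ and $I'_i=\bigcup_{j\le i} I_j$; (Weight) for $1\le i\le T$, $e_i\in R_i$ and $w(e_i)=f(I'_{i-1}\cup\{e_i\})-f(I'_{i-1})$; (Terminator) $R_{T+1}=\emptyset$. Then $I_T\in\mathcal{I}$ and $(4+\epsilon)\, f(I_T)\ge OPT$, where $OPT=\max_{I\in\mathcal{I}} f(I)$.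
   Context: $\textsc{Promote}(I,I',e,w)$, for $I\in\mathcal{I}$, $I'\subseteq V$, $e\in V$ and weights $w$ defined on the elements of $I$, is defined as follows: if $f(I'\cup\{e\})-f(I')\notin[\frac{\epsilon}{10k}MAX,\ MAX]$ it returns $\textsc{Fail}$; otherwise, if $I\cup\{e\}\in\mathcal{I}$ it returns $\emptyset$; otherwise let $C=\{e'\in I: (I\cup\{e\})\setminus\{e'\}\in\mathcal{I}\}$ and $\hat e\in\arg\min_{e'\in C} w(e')$, and it returns $\{\hat e\}$ if $2w(\hat e)\le f(I'\cup\{e\})-f(I')$ and $\textsc{Fail}$ otherwise. In the invariants, $\textsc{Promote}(I_{i-1},I'_{i-1},\cdot,w)$ uses the weights $w(e_j)$ of the elements $e_j$ of $I_{i-1}$ (note $I_{i-1}\subseteq\{e_1,\dots,e_{i-1}\}$). A function is submodular if $f(A\cup\{e\})-f(A)\ge f(B\cup\{e\})-f(B)$ for $A\subseteq B$, $e\notin B$; monotone if $A\subseteq B$ implies $f(A)\le f(B)$; normalized if $f(\emptyset)=0$. *)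

theory Defs
  imports Complex_Main
begin

locale matroid =
  fixes V :: "'a set" and \<I> :: "'a set set"
  assumes finite_ground: "finite V"
    and indep_subset_ground: "X \<in> \<I> \<Longrightarrow> X \<subseteq> V"
    and indep_empty: "{} \<in> \<I>"
    and indep_mono: "\<lbrakk>X \<in> \<I>; Y \<subseteq> X\<rbrakk> \<Longrightarrow> Y \<in> \<I>"
    and indep_exchange:
      "\<lbrakk>X \<in> \<I>; Y \<in> \<I>; card X < card Y\<rbrakk> \<Longrightarrow> \<exists>y \<in> Y - X. X \<union> {y} \<in> \<I>"

definition matroid_rank :: "'a set set \<Rightarrow> nat" where
  "matroid_rank \<I> = Max (card ` \<I>)"

definition submodular_on :: "'a set \<Rightarrow> ('a set \<Rightarrow> real) \<Rightarrow> bool" where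
  "submodular_on V f \<longleftrightarrow>
     (\<forall>A B e. A \<subseteq> B \<longrightarrow> B \<subseteq> V \<longrightarrow> e \<in> V - B \<longrightarrow>
        f (A \<union> {e}) - f A \<ge> f (B \<union> {e}) - f B)"

datatype 'a promote_result = Fail | Return "'a set"

text \<open>
  Promote chooses an arbitrary element of an arg min, so it is modelled by the set of its possible
  results, one for each choice; whether the result is \<^const>\<open>Fail\<close> does not depend on the
  choice (\<open>promote_Fail_unique\<close>). If the set \<open>C\<close> of exchange candidates is empty, then no
  choice exists and there is no possible result, in particular \<^const>\<open>Fail\<close> is not one.
  For an independent set \<open>I\<close> of a matroid this can happen only if \<open>e\<close> is a loop
  (\<open>promote_nonempty\<close>).
\<close>

definition promote ::
  "'a set set \<Rightarrow> ('a set \<Rightarrow> real) \<Rightarrow> nat \<Rightarrow> real \<Rightarrow> real \<Rightarrow>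
   'a set \<Rightarrow> 'a set \<Rightarrow> 'a \<Rightarrow> ('a \<Rightarrow> real) \<Rightarrow> 'a promote_result set" where
  "promote \<I> f k \<epsilon> M I I' e w =
     (let g = f (I' \<union> {e}) - f I' in
      if g \<notin> {\<epsilon> / (10 * real k) * M .. M} then {Fail}
      else if I \<union> {e} \<in> \<I> then {Return {}}
      else
        let C = {e' \<in> I. (I \<union> {e}) - {e'} \<in> \<I>} in
        {if 2 * w c \<le> g then Return {c} else Fail | c. is_arg_min w (\<lambda>x. x \<in> C) c})"

lemma promote_Fail_unique:
  assumes "Fail \<in> promote \<I> f k \<epsilon> M I I' e w"
  shows "promote \<I> f k \<epsilon> M I I' e w = {Fail}"
proof -
  have eq: "w c = w d" if "is_arg_min w P c" "is_arg_min w P d" for P :: "'a \<Rightarrow> bool" and c d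
    using that unfolding is_arg_min_def by (meson linorder_less_linear)
  show ?thesis
    using assms unfolding promote_def Let_def
    by (auto split: if_splits dest: eq)
qed

lemma (in matroid) promote_nonempty:
  assumes I: "I \<in> \<I>" and e: "{e} \<in> \<I>"
  shows "promote \<I> f k \<epsilon> M I I' e w \<noteq> {}"
proof (cases "I \<union> {e} \<in> \<I>")
  case True
  then show ?thesis by (simp add: promote_def Let_def)
next
  case False
  let ?C = "{e' \<in> I. (I \<union> {e}) - {e'} \<in> \<I>}"
  let ?S = "{J \<in> \<I>. e \<in> J \<and> J \<subseteq> I \<union> {e}}"
  have fI: "finite I" using I indep_subset_ground finite_ground finite_subset by blast
  then have fin: "finite ?S" by (auto intro: finite_subset[of _ "Pow (I \<union> {e})"])
  have "{e} \<in> ?S" using e by auto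
  with fin obtain J where J: "J \<in> ?S" and Jmax: "\<And>K. K \<in> ?S \<Longrightarrow> card K \<le> card J"
    by (metis (mono_tags, lifting) obtains_MAX empty_iff Max_ge finite_imageI image_eqI)
  have fJ: "finite J" using J fI by (auto intro: finite_subset)
  have "card I \<le> card J"
  proof (rule ccontr)
    assume "\<not> card I \<le> card J"
    then obtain y where y: "y \<in> I - J" "J \<union> {y} \<in> \<I>"
      using indep_exchange[of J I] J I by auto
    then have "card (J \<union> {y}) \<le> card J" using J by (intro Jmax) auto
    then show False using y fJ by simp
  qed
  have "J \<noteq> I \<union> {e}" using J False by auto
  then obtain x where x: "x \<in> I \<union> {e}" "x \<notin> J" using J by blast
  have xI: "x \<in> I" and sub: "J \<subseteq> (I \<union> {e}) - {x}" using x J by auto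
  have "e \<notin> I" using False I by (auto simp: insert_absorb)
  then have "card ((I \<union> {e}) - {x}) = card I" using fI xI by simp
  then have "J = (I \<union> {e}) - {x}"
    using card_seteq[OF _ sub] fI \<open>card I \<le> card J\<close> by simp
  then have "?C \<noteq> {}" using J xI by auto
  moreover have "finite ?C" using fI by simp
  ultimately have "is_arg_min w (\<lambda>x. x \<in> ?C) (arg_min_on w ?C)"
    using ex_is_arg_min_if_finite[of ?C w] unfolding arg_min_on_def arg_min_def
    by (rule_tac someI_ex) auto
  then show ?thesis using False unfolding promote_def Let_def by auto
qed

end

theory Submission
  imports Defs
begin

text \<open>
  Write \<open>w(A)\<close> for the total weight of \<open>A\<close>. Each swap gives back at most half of the weight it adds, so
  \<open>f(I'\<^sub>T) \<le> 2 w(I\<^sub>T)\<close>, and submodularity gives \<open>w(I\<^sub>T) \<le> f(I\<^sub>T)\<close>.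
  For every threshold \<open>t\<close> the span of the elements of \<open>I\<^sub>i\<close> of weight at least \<open>t\<close> grows with \<open>i\<close>.
  An element \<open>x\<close> rejected by the weight test with gain \<open>g\<close> is spanned by the elements of weight at
  least \<open>g/2\<close> at that time, hence also at time \<open>T\<close>; comparing cardinalities for every threshold, the
  rejected elements of an optimal set have total gain at most \<open>2 w(I\<^sub>T)\<close>. Those rejected for a small
  gain contribute at most \<open>\<epsilon>/10 MAX\<close> altogether, and applying the same trichotomy to a singleton of
  largest value shows \<open>MAX \<le> 10 w(I\<^sub>T)\<close>, even if this singleton is not independent.
\<close>

section \<open>Comparison of sums by thresholds, and submodular increments\<close>

text \<open>Greedy matching: taking \<open>t = g a\<close> for a maximiser \<open>a\<close> of
  \<open>g\<close> yields a partner \<open>b0\<close> that is at least as heavy. Deleting both keeps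
  the hypothesis, since both counts drop by one for \<open>t \<le> g a\<close> and the left one is
  zero above.\<close>

lemma sum_le_sum_if_card_superlevel_le:
  fixes g :: "'a \<Rightarrow> real" and w :: "'b \<Rightarrow> real"
  assumes "finite A" "finite B"
    and "\<And>b. b \<in> B \<Longrightarrow> 0 \<le> w b"
    and "\<And>t. card {a \<in> A. t \<le> g a} \<le> card {b \<in> B. t \<le> w b}"
  shows "sum g A \<le> sum w B"
  using assms
proof (induction "card A" arbitrary: A B)
  case 0
  then show ?case by (simp add: sum_nonneg)
next
  case (Suc n)
  then have "A \<noteq> {}" by auto
  with Suc.prems(1) obtain a where a: "a \<in> A" "\<And>x. x \<in> A \<Longrightarrow> g x \<le> g a"
    by (metis obtains_MAX Max_ge finite_imageI image_eqI)
  have "0 < card {x \<in> A. g a \<le> g x}"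
    using a(1) Suc.prems(1) by (auto simp: card_gt_0_iff)
  also have "\<dots> \<le> card {b \<in> B. g a \<le> w b}" by (rule Suc.prems(4))
  finally obtain b0 where b0: "b0 \<in> B" "g a \<le> w b0" by (auto simp: card_gt_0_iff)
  have "sum g (A - {a}) \<le> sum w (B - {b0})"
  proof (rule Suc.hyps(1))
    fix t
    show "card {x \<in> A - {a}. t \<le> g x} \<le> card {b \<in> B - {b0}. t \<le> w b}"
    proof (cases "t \<le> g a")
      case True
      then have eq: "{x \<in> A - {a}. t \<le> g x} = {x \<in> A. t \<le> g x} - {a}"
          "{b \<in> B - {b0}. t \<le> w b} = {b \<in> B. t \<le> w b} - {b0}"
        and mem: "a \<in> {x \<in> A. t \<le> g x}" "b0 \<in> {b \<in> B. t \<le> w b}"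
        using a b0 by auto
      show ?thesis
        unfolding eq card_Diff_singleton[OF mem(1)] card_Diff_singleton[OF mem(2)]
        using Suc.prems(4)[of t] by (rule diff_le_mono)
    next
      case False
      then have empty: "{x \<in> A - {a}. t \<le> g x} = {}" using a by force
      show ?thesis unfolding empty by simp
    qed
  qed (use Suc.hyps(2) Suc.prems a in auto)
  moreover have "sum g A = g a + sum g (A - {a})" "sum w B = w b0 + sum w (B - {b0})"
    using Suc.prems a b0 by (auto simp: sum.remove)
  ultimately show ?case using b0 by linarith
qed

lemma submodular_onD:
  assumes "submodular_on V f" "A \<subseteq> B" "B \<subseteq> V" "x \<in> V - B"
  shows "f (B \<union> {x}) - f B \<le> f (A \<union> {x}) - f A"
  using assms unfolding submodular_on_def by blast

lemma submodular_on_Un_le: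
  assumes "submodular_on V f" "A \<subseteq> V" "finite S" "S \<subseteq> V" "A \<inter> S = {}"
  shows "f (A \<union> S) \<le> f A + (\<Sum>x\<in>S. f (A \<union> {x}) - f A)"
  using assms(3-5)
proof (induction S)
  case (insert x S)
  have "f (A \<union> S \<union> {x}) - f (A \<union> S) \<le> f (A \<union> {x}) - f A"
    using insert assms(2) by (intro submodular_onD[OF assms(1)]) auto
  then show ?case using insert by (simp add: Un_insert_right)
qed simp

section \<open>Matroid span and exchange\<close>

context matroid
begin

text \<open>For independent \<open>S\<close> this is the matroid closure. A dependent
  \<open>S\<close> gets all of \<open>V\<close>, which makes monotonicity immediate.\<close>

definition spanned :: "'a set \<Rightarrow> 'a set" where
  "spanned S = {x \<in> V. x \<in> S \<or> S \<union> {x} \<notin> \<I>}"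

definition exchangeable :: "'a set \<Rightarrow> 'a \<Rightarrow> 'a set" where
  "exchangeable X x = {y \<in> X. (X \<union> {x}) - {y} \<in> \<I>}"

lemma finite_indep: "X \<in> \<I> \<Longrightarrow> finite X"
  using indep_subset_ground finite_ground finite_subset by blast

lemma finite_family: "finite \<I>"
proof (rule finite_subset)
  show "\<I> \<subseteq> Pow V" using indep_subset_ground by blast
  show "finite (Pow V)" using finite_ground by simp
qed

lemma card_le_rank: "X \<in> \<I> \<Longrightarrow> card X \<le> matroid_rank \<I>"
  unfolding matroid_rank_def using finite_family by simp

lemma spanned_mono: "A \<subseteq> B \<Longrightarrow> spanned A \<subseteq> spanned B"
  unfolding spanned_def using indep_mono[of "B \<union> {x}" "A \<union> {x}" for x] by blast

lemma card_le_if_subset_spanned: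
  assumes "J \<in> \<I>" "S \<in> \<I>" "J \<subseteq> spanned S"
  shows "card J \<le> card S"
proof (rule ccontr)
  assume "\<not> ?thesis"
  then obtain y where "y \<in> J - S" "S \<union> {y} \<in> \<I>"
    using indep_exchange[of S J] assms by auto
  then show False using assms(3) unfolding spanned_def by blast
qed

text \<open>If \<open>y\<close> left the span, \<open>A \<union> {x} \<union> {y}\<close> would be
  independent and larger than \<open>A \<union> {c}\<close>. Exchange would then add
  \<open>x\<close> or \<open>y\<close> to \<open>A \<union> {c}\<close>, but \<open>dep\<close>
  forbids \<open>x\<close>, and \<open>y\<close> is spanned.\<close>

lemma spanned_swap_subset:
  assumes c: "A \<union> {c} \<in> \<I>" and x: "x \<notin> A" and dep: "A \<union> {c} \<union> {x} \<notin> \<I>"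
  shows "spanned (A \<union> {c}) \<subseteq> spanned (A \<union> {x})"
proof
  fix y assume y: "y \<in> spanned (A \<union> {c})"
  show "y \<in> spanned (A \<union> {x})"
  proof (rule ccontr)
    assume "y \<notin> spanned (A \<union> {x})"
    then have ny: "y \<notin> A" "y \<noteq> x" and ind: "A \<union> {x} \<union> {y} \<in> \<I>"
      using y unfolding spanned_def by auto
    have "finite A" using finite_indep[OF c] by simp
    then have "card (A \<union> {c}) < card (A \<union> {x} \<union> {y})"
      using x ny by (simp add: card_insert_if)
    then obtain z where "z \<in> (A \<union> {x} \<union> {y}) - (A \<union> {c})" "A \<union> {c} \<union> {z} \<in> \<I>"
      using indep_exchange[OF c ind] by blast
    then show False using dep y unfolding spanned_def by auto
  qed
qed

text \<open>The exchangeable elements form the fundamental circuit of \<open>x\<close>, up to \<open>x\<close> itself.\<close>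

lemma exchangeable_Un_dependent:
  assumes X: "X \<in> \<I>" and dep: "X \<union> {x} \<notin> \<I>" and A: "exchangeable X x \<subseteq> A" "A \<subseteq> X"
  shows "A \<union> {x} \<notin> \<I>"
proof
  assume Ax: "A \<union> {x} \<in> \<I>"
  \<comment> \<open>A largest \<open>J\<close> in \<open>?S\<close> has at least
    \<open>card X\<close> elements but is not \<open>X \<union> {x}\<close>, so it omits exactly one
    \<open>y\<close>. This \<open>y\<close> is exchangeable, hence in \<open>A\<close>, which
    contradicts \<open>A \<subseteq> J\<close>.\<close>
  let ?S = "{J \<in> \<I>. A \<union> {x} \<subseteq> J \<and> J \<subseteq> X \<union> {x}}"
  have fX: "finite X" using X by (rule finite_indep)
  have "finite ?S" using finite_family by simp
  moreover have "A \<union> {x} \<in> ?S" using Ax A by auto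
  ultimately obtain J where J: "J \<in> ?S" and Jmax: "\<And>K. K \<in> ?S \<Longrightarrow> card K \<le> card J"
    by (metis (mono_tags, lifting) obtains_MAX empty_iff Max_ge finite_imageI image_eqI)
  have fJ: "finite J" using J finite_indep by auto
  have le: "card X \<le> card J"
  proof (rule ccontr)
    assume "\<not> card X \<le> card J"
    then obtain y where y: "y \<in> X - J" "J \<union> {y} \<in> \<I>"
      using indep_exchange[of J X] J X by auto
    then have "card (J \<union> {y}) \<le> card J" using J by (intro Jmax) auto
    then show False using y fJ by simp
  qed
  have "J \<noteq> X \<union> {x}" using J dep by auto
  then obtain y where y: "y \<in> X" "y \<notin> J" using J by blast
  have sub: "J \<subseteq> (X \<union> {x}) - {y}" using y J by auto
  have "x \<notin> X" using dep X by (auto simp: insert_absorb)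
  then have "card ((X \<union> {x}) - {y}) = card X" using fX y by simp
  then have "J = (X \<union> {x}) - {y}"
    using card_seteq[OF _ sub] fX le by simp
  then have "y \<in> exchangeable X x" using J y unfolding exchangeable_def by auto
  then show False using A y J by auto
qed

section \<open>Outcomes of \<open>promote\<close>\<close>

lemma promote_ReturnD:
  assumes "Return X \<in> promote \<I> f k \<epsilon> M J J' x w"
  shows "\<epsilon> / (10 * real k) * M \<le> f (J' \<union> {x}) - f J'"
    and "J \<union> {x} \<in> \<I> \<and> X = {} \<or>
      (\<exists>c. J \<union> {x} \<notin> \<I> \<and> is_arg_min w (\<lambda>y. y \<in> exchangeable J x) c
         \<and> 2 * w c \<le> f (J' \<union> {x}) - f J' \<and> X = {c})"
proof -
  have range: "f (J' \<union> {x}) - f J' \<in> {\<epsilon> / (10 * real k) * M .. M}"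
    using assms unfolding promote_def Let_def by (metis promote_result.distinct(1) singletonD)
  then show "\<epsilon> / (10 * real k) * M \<le> f (J' \<union> {x}) - f J'" by simp
  show "J \<union> {x} \<in> \<I> \<and> X = {} \<or>
      (\<exists>c. J \<union> {x} \<notin> \<I> \<and> is_arg_min w (\<lambda>y. y \<in> exchangeable J x) c
         \<and> 2 * w c \<le> f (J' \<union> {x}) - f J' \<and> X = {c})"
  proof (cases "J \<union> {x} \<in> \<I>")
    case True
    then show ?thesis using assms range unfolding promote_def Let_def by simp
  next
    case False
    then obtain c where "is_arg_min w (\<lambda>y. y \<in> exchangeable J x) c"
      and "Return X = (if 2 * w c \<le> f (J' \<union> {x}) - f J' then Return {c} else Fail)"
      using assms range unfolding promote_def Let_def exchangeable_def[symmetric] by auto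
    then show ?thesis using False by (metis promote_result.distinct(1) promote_result.inject)
  qed
qed

text \<open>The second assumption rules out failure by a gain above \<open>M\<close>; a gain that is
  too small and a failed weight test remain.\<close>

lemma promote_FailD:
  assumes "Fail \<in> promote \<I> f k \<epsilon> M J J' x w"
    and "f (J' \<union> {x}) - f J' \<le> M"
  shows "f (J' \<union> {x}) - f J' < \<epsilon> / (10 * real k) * M \<or>
      (\<exists>c. J \<union> {x} \<notin> \<I> \<and> is_arg_min w (\<lambda>y. y \<in> exchangeable J x) c
         \<and> f (J' \<union> {x}) - f J' < 2 * w c)"
proof (rule disjCI)
  assume no_arg: "\<not> (\<exists>c. J \<union> {x} \<notin> \<I> \<and> is_arg_min w (\<lambda>y. y \<in> exchangeable J x) c
      \<and> f (J' \<union> {x}) - f J' < 2 * w c)"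
  show "f (J' \<union> {x}) - f J' < \<epsilon> / (10 * real k) * M"
  proof (rule ccontr)
    assume "\<not> ?thesis"
    then have range: "f (J' \<union> {x}) - f J' \<in> {\<epsilon> / (10 * real k) * M .. M}"
      using assms(2) by simp
    have dep: "J \<union> {x} \<notin> \<I>"
      using assms(1) range unfolding promote_def Let_def by (auto split: if_split_asm)
    then obtain c where "is_arg_min w (\<lambda>y. y \<in> exchangeable J x) c"
      and "Fail = (if 2 * w c \<le> f (J' \<union> {x}) - f J' then Return {c} else Fail)"
      using assms(1) range unfolding promote_def Let_def exchangeable_def[symmetric] by auto
    then show False using no_arg dep by (metis not_le promote_result.distinct(1))
  qed
qed

end

section \<open>Runs of weighted exchanges\<close>

text \<open>Abstracts from \<open>f\<close>: the weight and span arguments use only distinct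
  elements, positive weights and the swap rule, with the weight of the new element in place of its
  gain.\<close>

locale exchange_run = matroid V \<I> for V :: "'a set" and \<I> +
  fixes T :: nat and I :: "nat \<Rightarrow> 'a set" and e :: "nat \<Rightarrow> 'a" and w :: "'a \<Rightarrow> real"
  assumes I_0: "I 0 = {}"
    and e_inj: "inj_on e {1..T}"
    and w_pos: "i \<in> {1..T} \<Longrightarrow> 0 < w (e i)"
    and step: "i < T \<Longrightarrow>
      (I i \<union> {e (Suc i)} \<in> \<I> \<and> I (Suc i) = I i \<union> {e (Suc i)}) \<or>
      (\<exists>c. I i \<union> {e (Suc i)} \<notin> \<I> \<and> is_arg_min w (\<lambda>x. x \<in> exchangeable (I i) (e (Suc i))) c
         \<and> 2 * w c \<le> w (e (Suc i)) \<and> I (Suc i) = (I i \<union> {e (Suc i)}) - {c})"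
begin

definition heavy :: "real \<Rightarrow> nat \<Rightarrow> 'a set" where
  "heavy t i = {c \<in> I i. t \<le> w c}"

lemma I_indep: "i \<le> T \<Longrightarrow> I i \<in> \<I>"
proof (induction i)
  case (Suc i)
  then show ?case using step[of i] by (auto simp: is_arg_min_def exchangeable_def)
qed (simp add: I_0 indep_empty)

lemma I_subset: "i \<le> T \<Longrightarrow> I i \<subseteq> e ` {1..i}"
proof (induction i)
  case (Suc i)
  have "e ` {1..Suc i} = insert (e (Suc i)) (e ` {1..i})" by (simp add: atLeastAtMostSuc_conv)
  moreover have "I (Suc i) \<subseteq> insert (e (Suc i)) (I i)"
    using step[OF Suc_le_lessD[OF Suc.prems]] by (elim disjE exE conjE) auto
  moreover have "I i \<subseteq> e ` {1..i}" using Suc by simp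
  ultimately show ?case by blast
qed (simp add: I_0)

lemma e_fresh: "i < T \<Longrightarrow> e (Suc i) \<notin> e ` {1..i}"
  using inj_on_image_mem_iff[OF e_inj, of "Suc i" "{1..i}"] by simp

text \<open>A new element always enters, because the element swapped out is an older one. This
  identifies \<open>I' i\<close> with the set of all elements chosen so far.\<close>

lemma Union_I: "i \<le> T \<Longrightarrow> (\<Union>j\<le>i. I j) = e ` {1..i}"
proof (induction i)
  case (Suc i)
  have e: "e (Suc i) \<notin> I i" using I_subset[of i] e_fresh[of i] Suc.prems by auto
  have "e (Suc i) \<in> I (Suc i)"
    using step[of i] Suc.prems e by (auto simp: is_arg_min_def exchangeable_def)
  moreover have "I (Suc i) \<subseteq> e ` {1..Suc i}" using I_subset Suc.prems by blast
  moreover have "e ` {1..Suc i} = insert (e (Suc i)) (e ` {1..i})"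
    by (simp add: atLeastAtMostSuc_conv)
  ultimately show ?case using Suc by (auto simp: atMost_Suc)
qed (simp add: I_0)

lemma w_pos_I:
  assumes "i \<le> T" "c \<in> I i"
  shows "0 < w c"
proof -
  obtain j where "j \<in> {1..i}" "c = e j" using I_subset assms by blast
  then show ?thesis using w_pos[of j] assms(1) by simp
qed

lemma weight_step:
  assumes i: "i < T"
  shows "sum w (I i) + w (e (Suc i)) / 2 \<le> sum w (I (Suc i))"
proof -
  have e: "e (Suc i) \<notin> I i" using I_subset[of i] e_fresh i by auto
  have fin: "finite (I i)" using I_indep[of i] finite_indep i by simp
  from step[OF i] show ?thesis
  proof (elim disjE exE conjE)
    assume "I (Suc i) = I i \<union> {e (Suc i)}"
    then show ?thesis using e fin w_pos[of "Suc i"] i by simp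
  next
    fix c
    assume arg: "is_arg_min w (\<lambda>x. x \<in> exchangeable (I i) (e (Suc i))) c"
      and c: "2 * w c \<le> w (e (Suc i))" and eq: "I (Suc i) = (I i \<union> {e (Suc i)}) - {c}"
    have "c \<in> I i" using arg by (auto simp: is_arg_min_def exchangeable_def)
    then have "sum w (I (Suc i)) = sum w (I i \<union> {e (Suc i)}) - w c"
      unfolding eq using fin by (subst sum_diff1) auto
    then show ?thesis using c e fin by simp
  qed
qed

lemma weight_mono:
  assumes "i \<le> j" "j \<le> T"
  shows "sum w (I i) \<le> sum w (I j)"
  using assms
proof (induction j rule: dec_induct)
  case (step n)
  then show ?case using weight_step[of n] w_pos[of "Suc n"] by simp
qed simp

lemma sum_all_le_weight: "i \<le> T \<Longrightarrow> (\<Sum>j=1..i. w (e j)) \<le> 2 * sum w (I i)"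
proof (induction i)
  case (Suc i)
  then show ?case using weight_step[of i] by simp
qed (simp add: I_0)

text \<open>If the removed \<open>c\<close> weighs less than \<open>t\<close>, the heavy part only
  grows. Otherwise minimality of \<open>c\<close> puts the whole circuit of the new element into the
  heavy part, and the new element is heavy too, so the heavy part itself undergoes a swap that
  preserves its span.\<close>

lemma spanned_heavy_step:
  assumes i: "i < T"
  shows "spanned (heavy t i) \<subseteq> spanned (heavy t (Suc i))"
proof -
  let ?x = "e (Suc i)"
  have x: "?x \<notin> I i" using I_subset[of i] e_fresh i by auto
  have Ii: "I i \<in> \<I>" using I_indep i by simp
  from step[OF i] show ?thesis
  proof (elim disjE exE conjE)
    assume "I (Suc i) = I i \<union> {?x}"
    then show ?thesis by (intro spanned_mono) (auto simp: heavy_def)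
  next
    fix c
    assume dep: "I i \<union> {?x} \<notin> \<I>"
      and arg: "is_arg_min w (\<lambda>y. y \<in> exchangeable (I i) ?x) c"
      and c: "2 * w c \<le> w ?x" and eq: "I (Suc i) = (I i \<union> {?x}) - {c}"
    have cI: "c \<in> I i" using arg by (auto simp: is_arg_min_def exchangeable_def)
    show ?thesis
    proof (cases "t \<le> w c")
      case False
      then show ?thesis using eq by (intro spanned_mono) (auto simp: heavy_def)
    next
      case True
      define A where "A = heavy t i - {c}"
      have Ac: "heavy t i = A \<union> {c}" using True cI by (auto simp: A_def heavy_def)
      have "t \<le> w ?x" using True c w_pos_I[OF _ cI] i by simp
      then have Ax: "heavy t (Suc i) = A \<union> {?x}"
        using eq x cI by (auto simp: A_def heavy_def)
      have "exchangeable (I i) ?x \<subseteq> heavy t i"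
        using arg True by (fastforce simp: is_arg_min_linorder heavy_def exchangeable_def)
      then have "A \<union> {c} \<union> {?x} \<notin> \<I>"
        using exchangeable_Un_dependent[OF Ii dep] Ac by (auto simp: heavy_def)
      moreover have "A \<union> {c} \<in> \<I>"
        using indep_mono[OF Ii] Ac by (auto simp: heavy_def)
      moreover have "?x \<notin> A" using x by (auto simp: A_def heavy_def)
      ultimately show ?thesis unfolding Ac Ax by (intro spanned_swap_subset)
    qed
  qed
qed

lemma spanned_heavy_mono:
  assumes "i \<le> j" "j \<le> T"
  shows "spanned (heavy t i) \<subseteq> spanned (heavy t j)"
  using assms
proof (induction j rule: dec_induct)
  case (step n)
  then show ?case using spanned_heavy_step[of n t] by force
qed simp

text \<open>The heavy part at time \<open>i\<close> contains the circuit of \<open>x\<close> and so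
  spans \<open>x\<close>; this persists up to time \<open>T\<close>.\<close>

lemma rejected_in_spanned_heavy:
  assumes i: "i \<le> T" and x: "x \<in> V" and dep: "I i \<union> {x} \<notin> \<I>"
    and t: "\<And>c. c \<in> exchangeable (I i) x \<Longrightarrow> t \<le> w c"
  shows "x \<in> spanned (heavy t T)"
proof -
  have "heavy t i \<union> {x} \<notin> \<I>"
  proof (rule exchangeable_Un_dependent[OF I_indep[OF i] dep])
    show "exchangeable (I i) x \<subseteq> heavy t i"
      using t unfolding heavy_def exchangeable_def by blast
  qed (simp add: heavy_def)
  then have "x \<in> spanned (heavy t i)" using x by (simp add: spanned_def)
  then show ?thesis using spanned_heavy_mono[OF i] by auto
qed

text \<open>For each \<open>t\<close>, the elements of \<open>J\<close> with \<open>h\<close> at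
  least \<open>t\<close> are independent and lie in the span of \<open>heavy t T\<close>, so there
  are at most \<open>card (heavy t T)\<close> of them.\<close>

lemma sum_le_weight_if_in_spanned_heavy:
  assumes J: "J \<in> \<I>" and h: "\<And>x. x \<in> J \<Longrightarrow> x \<in> spanned (heavy (h x) T)"
  shows "sum h J \<le> sum w (I T)"
proof (rule sum_le_sum_if_card_superlevel_le)
  show "finite J" "finite (I T)" using J I_indep finite_indep by auto
  show "0 \<le> w b" if "b \<in> I T" for b using w_pos_I[OF _ that] by simp
  fix t
  have "{x \<in> J. t \<le> h x} \<subseteq> spanned (heavy t T)"
  proof
    fix x assume x: "x \<in> {x \<in> J. t \<le> h x}"
    then have "spanned (heavy (h x) T) \<subseteq> spanned (heavy t T)"
      by (intro spanned_mono) (auto simp: heavy_def)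
    then show "x \<in> spanned (heavy t T)" using h x by auto
  qed
  moreover have "heavy t T \<in> \<I>"
    by (rule indep_mono[OF I_indep[of T]]) (auto simp: heavy_def)
  moreover have "{x \<in> J. t \<le> h x} \<in> \<I>" by (rule indep_mono[OF J]) auto
  ultimately show "card {x \<in> J. t \<le> h x} \<le> card {b \<in> I T. t \<le> w b}"
    using card_le_if_subset_spanned by (simp add: heavy_def)
qed

text \<open>Add the elements of \<open>A\<close> in order of arrival: the weight of each is its gain
  over all earlier elements, hence at most its gain over the earlier ones in
  \<open>A\<close>.\<close>

lemma weight_le_submodular:
  assumes sub: "submodular_on V f" and f0: "f {} = 0" and eV: "e ` {1..T} \<subseteq> V"
    and w: "\<And>i. i < T \<Longrightarrow> w (e (Suc i)) = f (e ` {1..i} \<union> {e (Suc i)}) - f (e ` {1..i})"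
  shows "i \<le> T \<Longrightarrow> A \<subseteq> e ` {1..i} \<Longrightarrow> sum w A \<le> f A"
proof (induction i arbitrary: A)
  case (Suc i)
  let ?x = "e (Suc i)"
  have img: "e ` {1..Suc i} = insert ?x (e ` {1..i})" by (simp add: atLeastAtMostSuc_conv)
  show ?case
  proof (cases "?x \<in> A")
    case True
    have sA: "A - {?x} \<subseteq> e ` {1..i}" using Suc.prems img by auto
    have IH: "sum w (A - {?x}) \<le> f (A - {?x})" using Suc sA by simp
    have "e ` {1..i} \<subseteq> e ` {1..T}" using Suc.prems(1) by (intro image_mono) auto
    then have "e ` {1..i} \<subseteq> V" using eV by blast
    moreover have "?x \<in> V - e ` {1..i}" using Suc.prems(1) eV e_fresh[of i] by auto
    ultimately have "w ?x \<le> f ((A - {?x}) \<union> {?x}) - f (A - {?x})"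
      unfolding w[OF Suc_le_lessD[OF Suc.prems(1)]] by (rule submodular_onD[OF sub sA])
    moreover have "(A - {?x}) \<union> {?x} = A" using True by auto
    moreover have "finite A" using Suc.prems(2) finite_subset by blast
    then have "sum w A = w ?x + sum w (A - {?x})" using True by (simp add: sum.remove)
    ultimately show ?thesis using IH by simp
  next
    case False
    then show ?thesis using Suc img by (simp add: subset_insert)
  qed
qed (simp add: f0)

end

section \<open>The approximation guarantee from the level invariants\<close>

theorem theorem6:
  fixes V :: "'a set" and \<I> :: "'a set set"
    and f :: "'a set \<Rightarrow> real" and \<epsilon> M :: real and k T :: nat
    and R I I' :: "nat \<Rightarrow> 'a set" and e :: "nat \<Rightarrow> 'a" and w :: "'a \<Rightarrow> real"
  assumes matroid: "matroid V \<I>"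
    and rank: "matroid_rank \<I> = k" "k \<ge> 1"
    and nonneg: "\<And>A. A \<subseteq> V \<Longrightarrow> f A \<ge> 0"
    and normalized: "f {} = 0"
    and monotone: "mono_on (Pow V) f"
    and submodular: "submodular_on V f"
    and eps: "0 < \<epsilon>" "\<epsilon> \<le> 1"
    and M_pos: "M > 0"
    and M: "Max ((\<lambda>x. f {x}) ` V) \<in> {M / 2 <.. M}"
    and R_sub: "\<And>i. i \<le> T + 1 \<Longrightarrow> R i \<subseteq> V"
    and I_sub: "\<And>i. i \<le> T \<Longrightarrow> I i \<subseteq> V"
    and I'_sub: "\<And>i. i \<le> T \<Longrightarrow> I' i \<subseteq> V"
    and e_in: "\<And>i. i \<in> {1..T} \<Longrightarrow> e i \<in> V"
    and Starter: "R 0 = V" "I 0 = {}" "I' 0 = {}"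
    and Survivor: "\<And>i. i \<in> {1..T + 1} \<Longrightarrow>
      R i = {x \<in> (if i = 1 then R 0 else R (i - 1) - {e (i - 1)}).
               Fail \<notin> promote \<I> f k \<epsilon> M (I (i - 1)) (I' (i - 1)) x w}"
    and Independent: "\<And>i. i \<in> {1..T} \<Longrightarrow>
      (\<exists>X. Return X \<in> promote \<I> f k \<epsilon> M (I (i - 1)) (I' (i - 1)) (e i) w
           \<and> I i = (I (i - 1) \<union> {e i}) - X)
      \<and> I' i = (\<Union>j\<le>i. I j)"
    and Weight: "\<And>i. i \<in> {1..T} \<Longrightarrow>
      e i \<in> R i \<and> w (e i) = f (I' (i - 1) \<union> {e i}) - f (I' (i - 1))"
    and Terminator: "R (T + 1) = {}"
  shows "I T \<in> \<I> \<and> (4 + \<epsilon>) * f (I T) \<ge> Max (f ` \<I>)"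
proof -
  interpret matroid V \<I> by (rule matroid)
  let ?\<theta> = "\<epsilon> / (10 * real k) * M"
  have \<theta>_pos: "0 < ?\<theta>" using eps M_pos rank by simp
  \<comment> \<open>\<open>e 0\<close> is an arbitrary value, so nothing is deleted at
    \<open>i = 0\<close>.\<close>
  have R_step: "R (Suc i) = {x \<in> (if i = 0 then V else R i - {e i}).
      Fail \<notin> promote \<I> f k \<epsilon> M (I i) (I' i) x w}" if "i \<le> T" for i
    using Survivor[of "Suc i"] that Starter by simp
  have R_anti: "R j \<subseteq> R i" if "i \<le> j" "j \<le> T + 1" for i j
    using that
  proof (induction j rule: dec_induct)
    case (step n)
    have "R (Suc n) \<subseteq> R n" using R_step[of n] step Starter by (auto split: if_splits)
    then show ?case using step by auto
  qed simp
  \<comment> \<open>\<open>e i\<close> is deleted from \<open>R (Suc i)\<close>, whereas a later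
    \<open>e j\<close> still lies in it.\<close>
  have inj: "inj_on e {1..T}"
  proof (rule linorder_inj_onI)
    fix i j assume ij: "i < j" "i \<in> {1..T}" "j \<in> {1..T}"
    then have iT: "i < T" by simp
    have "e j \<in> R (Suc i)" using Weight[of j] R_anti[of "Suc i" j] ij by auto
    moreover have "e i \<notin> R (Suc i)" unfolding R_step[OF less_imp_le[OF iT]] using ij by simp
    ultimately show "e i \<noteq> e j" by metis
  qed auto
  have weight: "w (e (Suc i)) = f (I' i \<union> {e (Suc i)}) - f (I' i)" if "i < T" for i
    using Weight[of "Suc i"] that by simp
  have returned: "\<exists>X. Return X \<in> promote \<I> f k \<epsilon> M (I i) (I' i) (e (Suc i)) w
      \<and> I (Suc i) = (I i \<union> {e (Suc i)}) - X" if "i < T" for i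
    using Independent[of "Suc i"] that by simp
  interpret exchange_run V \<I> T I e w
  proof
    show "I 0 = {}" by (rule Starter)
    show "inj_on e {1..T}" by (rule inj)
    show "0 < w (e i)" if "i \<in> {1..T}" for i
    proof -
      obtain j where j: "i = Suc j" "j < T" using \<open>i \<in> {1..T}\<close> by (cases i) auto
      obtain X where "Return X \<in> promote \<I> f k \<epsilon> M (I j) (I' j) (e (Suc j)) w"
        using returned[OF j(2)] by blast
      from promote_ReturnD(1)[OF this] show ?thesis using weight[OF j(2)] \<theta>_pos j(1) by simp
    qed
    show "(I i \<union> {e (Suc i)} \<in> \<I> \<and> I (Suc i) = I i \<union> {e (Suc i)}) \<or>
      (\<exists>c. I i \<union> {e (Suc i)} \<notin> \<I> \<and> is_arg_min w (\<lambda>x. x \<in> exchangeable (I i) (e (Suc i))) c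
         \<and> 2 * w c \<le> w (e (Suc i)) \<and> I (Suc i) = (I i \<union> {e (Suc i)}) - {c})" if i: "i < T" for i
    proof -
      obtain X where X: "Return X \<in> promote \<I> f k \<epsilon> M (I i) (I' i) (e (Suc i)) w"
        and eq: "I (Suc i) = (I i \<union> {e (Suc i)}) - X"
        using returned[OF i] by blast
      from promote_ReturnD(2)[OF X] show ?thesis
        unfolding weight[OF i] eq by (elim disjE exE conjE) (simp, blast)
    qed
  qed
  have I': "I' i = e ` {1..i}" if "i \<le> T" for i
    using that Independent[of i] Union_I[of i] Starter(3) by (cases "i = 0") auto
  have eV: "e ` {1..T} \<subseteq> V" using e_in by auto
  define W where "W = sum w (I T)"
  define gain where "gain x = f (I' T \<union> {x}) - f (I' T)" for x

  have W_le: "W \<le> f (I T)"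
    unfolding W_def
    using weight_le_submodular[OF submodular normalized eV _ order_refl I_subset] weight I'
    by simp
  \<comment> \<open>The weights are the successive increments of \<open>f\<close> along
    \<open>I'\<close>, so their sum telescopes.\<close>
  have "f (I' i) = (\<Sum>j=1..i. w (e j))" if "i \<le> T" for i
    using that
  proof (induction i)
    case (Suc i)
    have "e ` {1..Suc i} = e ` {1..i} \<union> {e (Suc i)}" by (simp add: atLeastAtMostSuc_conv)
    then show ?case using Suc weight[of i] I'[of i] I'[of "Suc i"] by simp
  qed (simp add: Starter normalized)
  then have f_I': "f (I' i) \<le> 2 * sum w (I i)" if "i \<le> T" for i
    using sum_all_le_weight that by simp
  have mono: "f A \<le> f B" if "A \<subseteq> B" "B \<subseteq> V" for A B
    using monotone that by (auto simp: mono_on_def)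
  have f_single: "f {x} \<le> M" if "x \<in> V" for x
  proof -
    have "f {x} \<le> Max ((\<lambda>x. f {x}) ` V)" using that finite_ground by (intro Max_ge) auto
    then show ?thesis using M by simp
  qed

  \<comment> \<open>Otherwise \<open>x\<close> would survive into the empty
    \<open>R (T + 1)\<close>. An empty set of results does not contain \<open>Fail\<close> and so
    also counts as survival.\<close>
  have dropped: "x \<in> e ` {1..T} \<or> (\<exists>j\<le>T. Fail \<in> promote \<I> f k \<epsilon> M (I j) (I' j) x w)"
    if "x \<in> V" for x
  proof (rule ccontr)
    assume contr: "\<not> ?thesis"
    have "x \<in> R i" if "i \<le> T + 1" for i
      using that
    proof (induction i)
      case (Suc i)
      have iT: "i \<le> T" using Suc.prems by simp
      have "x \<noteq> e i" if "i \<noteq> 0" using contr that iT by auto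
      moreover have "x \<in> R i" using Suc by simp
      moreover have "Fail \<notin> promote \<I> f k \<epsilon> M (I i) (I' i) x w" using contr iT by blast
      ultimately show ?case unfolding R_step[OF iT] using \<open>x \<in> V\<close> by simp
    qed (use \<open>x \<in> V\<close> Starter in simp)
    then show False using Terminator by blast
  qed
  \<comment> \<open>The span statement serves the optimal set; the bound by \<open>W\<close> serves
    a largest singleton, which may be dependent and then escapes the cardinality comparison.\<close>
  have rejected: "gain x \<le> ?\<theta> \<or> (gain x / 2 \<le> W \<and> x \<in> spanned (heavy (gain x / 2) T))"
    if x: "x \<in> V" "x \<notin> I' T" for x
  proof -
    obtain j where j: "j \<le> T" "Fail \<in> promote \<I> f k \<epsilon> M (I j) (I' j) x w"
      using dropped[of x] x I' by auto
    have sub: "I' j \<subseteq> I' T" "I' T \<subseteq> V" using I' j I'_sub by auto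
    have le: "gain x \<le> f (I' j \<union> {x}) - f (I' j)"
      using submodular_onD[OF submodular sub] x by (simp add: gain_def)
    \<comment> \<open>Submodularity bounds every gain by a singleton value, so no element fails for
      exceeding \<open>M\<close>.\<close>
    have "f (I' j \<union> {x}) - f (I' j) \<le> f ({} \<union> {x}) - f {}"
      using submodular_onD[OF submodular, of "{}" "I' j" x] x sub by auto
    then have "f (I' j \<union> {x}) - f (I' j) \<le> M" using f_single x normalized by fastforce
    from promote_FailD[OF j(2) this] show ?thesis
    proof (elim disjE exE conjE)
      fix c
      assume dep: "I j \<union> {x} \<notin> \<I>"
        and arg: "is_arg_min w (\<lambda>y. y \<in> exchangeable (I j) x) c"
        and c: "f (I' j \<union> {x}) - f (I' j) < 2 * w c"
      have "c \<in> I j" using arg by (auto simp: is_arg_min_def exchangeable_def)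
      then have "w c \<le> sum w (I j)"
        using w_pos_I[OF j(1)] finite_indep[OF I_indep[OF j(1)]]
        by (intro member_le_sum) (auto intro: less_imp_le)
      also have "\<dots> \<le> W" unfolding W_def using weight_mono j by simp
      finally have "gain x / 2 \<le> W" using c le by simp
      moreover have "x \<in> spanned (heavy (gain x / 2) T)"
        using arg c le
        by (intro rejected_in_spanned_heavy[OF j(1) x(1) dep]) (force simp: is_arg_min_linorder)
      ultimately show ?thesis by simp
    qed (use le in simp)
  qed

  have I'T: "I' T \<subseteq> V" using I'_sub by simp
  \<comment> \<open>From \<open>M / 2 < 2 * W + gain x\<close>, a small gain gives
    \<open>M < 5 * W\<close> and a failed weight test \<open>M < 8 * W\<close>. The factor 10 is
    chosen to cancel the one in \<open>?\<theta>\<close>.\<close>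
  have M_le: "M \<le> 10 * W"
  proof -
    have "V \<noteq> {}"
    proof
      assume "V = {}"
      then have "\<I> = {{}}" using indep_subset_ground indep_empty by auto
      then show False using rank by (simp add: matroid_rank_def)
    qed
    then obtain x where x: "x \<in> V" "Max ((\<lambda>x. f {x}) ` V) = f {x}"
      using obtains_MAX[OF finite_ground, of "\<lambda>x. f {x}"] by metis
    have x_max: "M / 2 < f {x}" using M x(2) by simp
    have fx: "f {x} \<le> f (I' T) + gain x"
      using mono[of "{x}" "I' T \<union> {x}"] x I'T by (auto simp: gain_def)
    have "?\<theta> \<le> M / 10"
    proof -
      have "\<epsilon> / real k \<le> 1" using eps rank by (simp add: divide_le_eq)
      then have "(\<epsilon> / real k) * M \<le> 1 * M" using M_pos by (intro mult_right_mono) auto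
      then show ?thesis by simp
    qed
    moreover have "gain x = 0" if "x \<in> I' T" using that by (simp add: gain_def insert_absorb)
    ultimately have "gain x \<le> M / 10 \<or> gain x / 2 \<le> W"
      using rejected[OF x(1)] M_pos by (metis divide_nonneg_pos less_imp_le order_trans zero_less_numeral)
    then show ?thesis using fx x_max f_I'[of T] M_pos unfolding W_def[symmetric] by auto
  qed

  have "f Z \<le> (4 + \<epsilon>) * f (I T)" if opt: "Z \<in> \<I>" for Z
  proof -
    \<comment> \<open>Only elements of \<open>Z\<close> that were never chosen can add to
      \<open>f (I' T)\<close>. Those in \<open>A\<close> have a small gain, and the others failed
      the weight test.\<close>
    define S where "S = Z - I' T"
    define A where "A = {x \<in> S. gain x \<le> ?\<theta>}"
    have ZV: "Z \<subseteq> V" using opt indep_subset_ground by blast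
    have fS: "finite S" using finite_indep[OF opt] by (simp add: S_def)
    have "f Z \<le> f (I' T \<union> S)" using ZV I'T by (intro mono) (auto simp: S_def)
    also have "\<dots> \<le> f (I' T) + sum gain S"
      unfolding gain_def using ZV fS
      by (intro submodular_on_Un_le[OF submodular I'T]) (auto simp: S_def)
    also have "sum gain S = sum gain A + sum gain (S - A)"
      using sum.subset_diff[of A S gain] fS by (simp add: A_def)
    finally have 1: "f Z \<le> f (I' T) + sum gain A + sum gain (S - A)" by simp
    have "sum gain A \<le> of_nat (card A) * ?\<theta>" by (rule sum_bounded_above) (simp add: A_def)
    also have "\<dots> \<le> of_nat k * ?\<theta>"
    proof (rule mult_right_mono)
      have "card A \<le> card Z"
        using finite_indep[OF opt] by (intro card_mono) (auto simp: A_def S_def)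
      then show "real (card A) \<le> real k" using card_le_rank[OF opt] rank by simp
    qed (use \<theta>_pos in simp)
    also have "\<dots> = \<epsilon> * (M / 10)" using rank by simp
    also have "\<dots> \<le> \<epsilon> * W" using M_le eps by (intro mult_left_mono) auto
    finally have 2: "sum gain A \<le> \<epsilon> * W" .
    \<comment> \<open>A failed test guarantees a span only at threshold \<open>gain x / 2\<close>;
      this halving costs a factor 2.\<close>
    have "(\<Sum>x\<in>S - A. gain x / 2) \<le> W"
      unfolding W_def
    proof (rule sum_le_weight_if_in_spanned_heavy)
      show "S - A \<in> \<I>" by (rule indep_mono[OF opt]) (auto simp: S_def)
    qed (use rejected ZV in \<open>auto simp: A_def S_def\<close>)
    then have 3: "sum gain (S - A) \<le> 2 * W" by (simp flip: sum_divide_distrib)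
    \<comment> \<open>The factor is composed of 2 from \<open>f (I' T)\<close>, \<epsilon> from
      \<open>A\<close> and 2 from \<open>S - A\<close>.\<close>
    have "f Z \<le> (4 + \<epsilon>) * W"
      using 1 2 3 f_I'[of T] by (simp add: W_def algebra_simps)
    also have "\<dots> \<le> (4 + \<epsilon>) * f (I T)" using W_le eps by (intro mult_left_mono) auto
    finally show ?thesis .
  qed
  then have "Max (f ` \<I>) \<le> (4 + \<epsilon>) * f (I T)"
    using finite_family indep_empty by (intro Max.boundedI) auto
  then show ?thesis using I_indep by simp
qed

end
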